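(* Let $a>1$ and suppose that $(\lambda_n)_{n\ge1}$ has precisely one zero and one non-zero initial point with respect to $a$. Let $b\in\mathbb{C}$ be such that $C_{az+b}$ is a bounded composition operator on $\mathcal{H}(\beta,\Lambda)$, and suppose that $\operatorname{Re}(b)>a\beta_*$ and $\operatorname{Re}(b)\geq0$. Then $C_{az+b}$ is cyclic.
   Context: $\mathbb{N}=\{1,2,\dots\}$. $\Lambda=(\lambda_n)_{n\ge1}$ is a strictly increasing sequence of non-negative real numbers tending to $\infty$ with $L:=\limsup_{n\to\infty}\frac{\log n}{\lambda_n}<\infty$. $\beta=(\beta_n)_{n\ge1}$ is a sequence of positive real numbers with $\beta_*:=\liminf_{n\to\infty}\frac{\log\beta_n}{\lambda_n}\neq\pm\infty$. For $r\in\mathbb{R}$, $\mathbb{C}_r=\{z\in\mathbb{C}:\operatorname{Re}(z)>r\}$. $\mathcal{H}(\beta,\Lambda)$ is the space of Dirichlet series $f(z)=\sum_{n=1}^\infty a_ne^{-\lambda_nz}$ with $\sum_{n=1}^\infty|a_n|^2\beta_n^2<\infty$; such series converge to holomorphic functions on $\mathbb{C}_{L/2-\beta_*}$, their coefficients are uniquely determined by $f$, and $\mathcal{H}(\beta,\Lambda)$ is a Hilbert space with inner product $\langle f,g\rangle=\sum_{n}a_n\overline{b_n}\beta_n^2$. $C_\varphi f=f\circ\varphi$ ($C_{az+b}$ is $C_\varphi$ for $\varphi(z)=az+b$); "$C_\varphi$ is a bounded composition operator on $\mathcal{H}(\beta,\Lambda)$" means that $\varphi$ is a holomorphic self-map of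 $\mathbb{C}_{L/2-\beta_*}$ and $C_\varphi$ maps $\mathcal{H}(\beta,\Lambda)$ into itself boundedly. A term $\lambda_k$ is an initial point with respect to $a$ if there is no $n<k$ such that $a^s\lambda_n=\lambda_k$ for some $s\in\mathbb{N}$. Having precisely one zero and one non-zero initial point means that $\lambda_1=0$ and $\lambda_n=\lambda_2a^{n-2}$ for $n\ge2$. A bounded operator $T$ on a Hilbert space $\mathcal{H}$ is cyclic if there is $x\in\mathcal{H}$ such that the linear span of $\operatorname{Orb}(T,x)=\{T^nx:n=0,1,2,\dots\}$ is dense in $\mathcal{H}$. *)

theory Defs
  imports "HOL-Analysis.Analysis" "HOL-Library.Function_Algebras"
begin

text \<open>
  Sequences are indexed from 0, so that \<open>\<Lambda> n\<close>, \<open>\<beta> n\<close> and \<open>a n\<close> stand for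
  the mathematical $\lambda_{n+1}$, $\beta_{n+1}$ and $a_{n+1}$.  The value of the
  quotients below at a single index with \<open>\<Lambda> n = 0\<close> does not affect the limits.
\<close>

definition freq_limsup :: "(nat \<Rightarrow> real) \<Rightarrow> ereal" where
  "freq_limsup \<Lambda> = limsup (\<lambda>n. ereal (ln (real (Suc n)) / \<Lambda> n))"

definition weight_liminf :: "(nat \<Rightarrow> real) \<Rightarrow> (nat \<Rightarrow> real) \<Rightarrow> ereal" where
  "weight_liminf \<beta> \<Lambda> = liminf (\<lambda>n. ereal (ln (\<beta> n) / \<Lambda> n))"

definition half_plane :: "real \<Rightarrow> complex set" where
  "half_plane r = {z. Re z > r}"

definition dirichlet_domain :: "(nat \<Rightarrow> real) \<Rightarrow> (nat \<Rightarrow> real) \<Rightarrow> complex set" where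
  "dirichlet_domain \<beta> \<Lambda> =
     half_plane (real_of_ereal (freq_limsup \<Lambda>) / 2 - real_of_ereal (weight_liminf \<beta> \<Lambda>))"

definition dirichlet_expansion ::
    "(nat \<Rightarrow> real) \<Rightarrow> (nat \<Rightarrow> real) \<Rightarrow> (nat \<Rightarrow> complex) \<Rightarrow> (complex \<Rightarrow> complex) \<Rightarrow> bool" where
  "dirichlet_expansion \<beta> \<Lambda> a f \<longleftrightarrow>
     summable (\<lambda>n. (cmod (a n))\<^sup>2 * (\<beta> n)\<^sup>2) \<and>
     (\<forall>z \<in> dirichlet_domain \<beta> \<Lambda>. (\<lambda>n. a n * exp (- (of_real (\<Lambda> n) * z))) sums f z)"

text \<open>
  An element of the space is a function on the half-plane; it is represented by its
  extension by 0 to the whole plane, so that equality of representatives is equality of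
  functions on the half-plane and the pointwise operations give the vector space structure.
\<close>

definition dirichlet_space ::
    "(nat \<Rightarrow> real) \<Rightarrow> (nat \<Rightarrow> real) \<Rightarrow> (complex \<Rightarrow> complex) set" where
  "dirichlet_space \<beta> \<Lambda> =
     {f. (\<exists>a. dirichlet_expansion \<beta> \<Lambda> a f) \<and> (\<forall>z. z \<notin> dirichlet_domain \<beta> \<Lambda> \<longrightarrow> f z = 0)}"

definition dirichlet_coeff ::
    "(nat \<Rightarrow> real) \<Rightarrow> (nat \<Rightarrow> real) \<Rightarrow> (complex \<Rightarrow> complex) \<Rightarrow> nat \<Rightarrow> complex" where
  "dirichlet_coeff \<beta> \<Lambda> f = (THE a. dirichlet_expansion \<beta> \<Lambda> a f)"

definition dirichlet_inner ::
    "(nat \<Rightarrow> real) \<Rightarrow> (nat \<Rightarrow> real) \<Rightarrow> (complex \<Rightarrow> complex) \<Rightarrow> (complex \<Rightarrow> complex) \<Rightarrow> complex" where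
  "dirichlet_inner \<beta> \<Lambda> f g =
     (\<Sum>n. dirichlet_coeff \<beta> \<Lambda> f n * cnj (dirichlet_coeff \<beta> \<Lambda> g n) * of_real ((\<beta> n)\<^sup>2))"

definition dirichlet_norm ::
    "(nat \<Rightarrow> real) \<Rightarrow> (nat \<Rightarrow> real) \<Rightarrow> (complex \<Rightarrow> complex) \<Rightarrow> real" where
  "dirichlet_norm \<beta> \<Lambda> f = sqrt (Re (dirichlet_inner \<beta> \<Lambda> f f))"

definition comp_op ::
    "(nat \<Rightarrow> real) \<Rightarrow> (nat \<Rightarrow> real) \<Rightarrow> (complex \<Rightarrow> complex) \<Rightarrow>
     (complex \<Rightarrow> complex) \<Rightarrow> (complex \<Rightarrow> complex)" where
  "comp_op \<beta> \<Lambda> \<phi> f = (\<lambda>z. if z \<in> dirichlet_domain \<beta> \<Lambda> then f (\<phi> z) else 0)"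

definition bounded_comp_op ::
    "(nat \<Rightarrow> real) \<Rightarrow> (nat \<Rightarrow> real) \<Rightarrow> (complex \<Rightarrow> complex) \<Rightarrow> bool" where
  "bounded_comp_op \<beta> \<Lambda> \<phi> \<longleftrightarrow>
     \<phi> holomorphic_on dirichlet_domain \<beta> \<Lambda> \<and>
     \<phi> ` dirichlet_domain \<beta> \<Lambda> \<subseteq> dirichlet_domain \<beta> \<Lambda> \<and>
     comp_op \<beta> \<Lambda> \<phi> ` dirichlet_space \<beta> \<Lambda> \<subseteq> dirichlet_space \<beta> \<Lambda> \<and>
     (\<exists>K. \<forall>f \<in> dirichlet_space \<beta> \<Lambda>.
        dirichlet_norm \<beta> \<Lambda> (comp_op \<beta> \<Lambda> \<phi> f) \<le> K * dirichlet_norm \<beta> \<Lambda> f)"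

definition initial_point :: "real \<Rightarrow> (nat \<Rightarrow> real) \<Rightarrow> nat \<Rightarrow> bool" where
  "initial_point a \<Lambda> k \<longleftrightarrow> \<not> (\<exists>n<k. \<exists>s\<ge>1. a ^ s * \<Lambda> n = \<Lambda> k)"

definition one_zero_one_nonzero_initial :: "real \<Rightarrow> (nat \<Rightarrow> real) \<Rightarrow> bool" where
  "one_zero_one_nonzero_initial a \<Lambda> \<longleftrightarrow>
     (\<exists>!k. initial_point a \<Lambda> k \<and> \<Lambda> k = 0) \<and> (\<exists>!k. initial_point a \<Lambda> k \<and> \<Lambda> k \<noteq> 0)"

text \<open>
  The condition on initial points is implied by the explicit form of the frequencies, and it
  is equivalent to it once the frequencies are closed under multiplication by \<open>a\<close>, as they
  are when \<open>z \<mapsto> a z + b\<close> induces a composition operator on the space.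
\<close>

lemma one_zero_one_nonzero_initialI:
  assumes mono: "strict_mono \<Lambda>"
    and zero: "\<Lambda> 0 = 0" and geom: "\<And>n. \<Lambda> (Suc n) = \<Lambda> 1 * a ^ n"
  shows "one_zero_one_nonzero_initial a \<Lambda>"
proof -
  have pos: "\<Lambda> k > 0 \<longleftrightarrow> k > 0" for k
    using mono zero by (metis strict_mono_less)
  have nz: "\<Lambda> k = 0 \<longleftrightarrow> k = 0" for k
    using mono zero by (metis strict_mono_eq)
  have i0: "initial_point a \<Lambda> 0" by (simp add: initial_point_def)
  have i1: "initial_point a \<Lambda> 1"
    using pos[of 1] zero by (auto simp: initial_point_def)
  have "\<not> initial_point a \<Lambda> (Suc (Suc n))" for n
  proof -
    have "a ^ 1 * \<Lambda> (Suc n) = \<Lambda> (Suc (Suc n))"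
      using geom[of n] geom[of "Suc n"] by simp
    then show ?thesis
      unfolding initial_point_def by (metis le_refl lessI)
  qed
  then have "initial_point a \<Lambda> k \<Longrightarrow> k = 0 \<or> k = 1" for k
    by (metis One_nat_def not0_implies_Suc)
  then show ?thesis
    using i0 i1 nz zero unfolding one_zero_one_nonzero_initial_def by (metis zero_neq_one)
qed

lemma one_zero_one_nonzero_initial_iff:
  assumes mono: "strict_mono \<Lambda>" and nonneg: "\<And>n. \<Lambda> n \<ge> 0" and a: "a > 1"
    and closed: "\<And>n. \<exists>m. \<Lambda> m = a * \<Lambda> n"
  shows "one_zero_one_nonzero_initial a \<Lambda> \<longleftrightarrow>
           \<Lambda> 0 = 0 \<and> (\<forall>n. \<Lambda> (Suc n) = \<Lambda> 1 * a ^ n)"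
proof
  assume *: "one_zero_one_nonzero_initial a \<Lambda>"
  then obtain k where "\<Lambda> k = 0"
    by (auto simp: one_zero_one_nonzero_initial_def)
  then have zero: "\<Lambda> 0 = 0"
    using mono nonneg[of 0] by (metis order.antisym strict_mono_less_eq zero_le)
  have pos: "\<Lambda> (Suc k) > 0" for k
    using mono zero by (metis strict_mono_less zero_less_Suc)
  have i1: "initial_point a \<Lambda> 1"
    using pos[of 0] zero by (auto simp: initial_point_def)
  have uniq: "k = 1" if "initial_point a \<Lambda> k" "\<Lambda> k \<noteq> 0" for k
    using * that i1 pos[of 0] unfolding one_zero_one_nonzero_initial_def
    by (metis One_nat_def less_irrefl)
  have pow: "\<exists>s. \<Lambda> (Suc k) = \<Lambda> 1 * a ^ s" for k
  proof (induction k rule: less_induct)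
    case (less k)
    show ?case
    proof (cases "k = 0")
      case True
      then show ?thesis by (intro exI[of _ 0]) simp
    next
      case False
      then have "\<not> initial_point a \<Lambda> (Suc k)"
        using uniq[of "Suc k"] pos[of k] by auto
      then obtain n s where n: "n < Suc k" "a ^ s * \<Lambda> n = \<Lambda> (Suc k)"
        by (auto simp: initial_point_def)
      then have "n \<noteq> 0" using zero pos[of k] by (metis less_irrefl mult_zero_right)
      then obtain m where m: "n = Suc m" by (metis not0_implies_Suc)
      then obtain t where "\<Lambda> n = \<Lambda> 1 * a ^ t" using less[of m] n by auto
      then have "\<Lambda> (Suc k) = \<Lambda> 1 * a ^ (s + t)" using n by (metis mult.left_commute power_add)
      then show ?thesis by blast
    qed
  qed
  have L1: "\<Lambda> 1 > 0" using pos[of 0] by simp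
  have step: "\<Lambda> (Suc (Suc k)) = a * \<Lambda> (Suc k)" for k
  proof -
    obtain m where m: "\<Lambda> m = a * \<Lambda> (Suc k)" using closed by blast
    have "\<Lambda> (Suc k) < \<Lambda> m" using m a pos[of k] by simp
    then have le: "\<Lambda> (Suc (Suc k)) \<le> a * \<Lambda> (Suc k)"
      using mono m by (metis Suc_leI strict_mono_less strict_mono_less_eq)
    obtain s t where s: "\<Lambda> (Suc k) = \<Lambda> 1 * a ^ s" and t: "\<Lambda> (Suc (Suc k)) = \<Lambda> 1 * a ^ t"
      using pow by blast
    have "\<Lambda> (Suc k) < \<Lambda> (Suc (Suc k))" using mono by (simp add: strict_mono_less)
    then have "a ^ s < a ^ t" using s t L1 by simp
    then have "Suc s \<le> t" using a by (simp add: Suc_leI)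
    then have "a ^ Suc s \<le> a ^ t" using a by (intro power_increasing) auto
    then have "a * \<Lambda> (Suc k) \<le> \<Lambda> (Suc (Suc k))"
      using s t L1 by (simp add: mult.left_commute)
    with le show ?thesis by simp
  qed
  have "\<Lambda> (Suc n) = \<Lambda> 1 * a ^ n" for n
    by (induction n) (simp_all add: step)
  with zero show "\<Lambda> 0 = 0 \<and> (\<forall>n. \<Lambda> (Suc n) = \<Lambda> 1 * a ^ n)" by blast
next
  assume "\<Lambda> 0 = 0 \<and> (\<forall>n. \<Lambda> (Suc n) = \<Lambda> 1 * a ^ n)"
  then show "one_zero_one_nonzero_initial a \<Lambda>"
    using one_zero_one_nonzero_initialI[OF mono] by blast
qed

text \<open>
  The distribution has no class of complex vector spaces, so the complex linear span is taken
  with respect to an explicit scalar multiplication on complex-valued functions.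
\<close>

definition fun_scale :: "complex \<Rightarrow> ('a \<Rightarrow> complex) \<Rightarrow> ('a \<Rightarrow> complex)" where
  "fun_scale c f = (\<lambda>z. c * f z)"

lemma vector_space_fun_scale: "vector_space fun_scale"
  by unfold_locales (auto simp: fun_scale_def algebra_simps fun_eq_iff)

definition orbit_of :: "('v \<Rightarrow> 'v) \<Rightarrow> 'v \<Rightarrow> 'v set" where
  "orbit_of T x = range (\<lambda>n. (T ^^ n) x)"

text \<open>
  Cyclicity of an operator \<open>T\<close> on the space of functions \<open>H\<close> with norm \<open>N\<close>;
  \<open>T\<close> is meant to be linear and bounded and to map \<open>H\<close> into itself.
\<close>

definition cyclic_on ::
    "('a \<Rightarrow> complex) set \<Rightarrow> (('a \<Rightarrow> complex) \<Rightarrow> real) \<Rightarrow>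
     (('a \<Rightarrow> complex) \<Rightarrow> ('a \<Rightarrow> complex)) \<Rightarrow> bool" where
  "cyclic_on H N T \<longleftrightarrow>
     (\<exists>x\<in>H. \<forall>y\<in>H. \<forall>e>0. \<exists>u \<in> module.span fun_scale (orbit_of T x). N (y - u) < e)"

end

theory Submission
  imports Defs
begin

text \<open>
  Write \<open>e\<^sub>n\<close> for the exponential with frequency \<open>\<Lambda> n\<close>. The frequencies are \<open>0\<close>
  followed by a geometric progression with ratio \<open>a\<close>, so \<open>T = C\<^sub>\<phi>\<close> with
  \<open>\<phi> z = a z + b\<close> fixes the constant function \<open>e\<^sub>0\<close> and sends \<open>e\<^sub>n\<close> to a non-zero
  multiple of \<open>e\<^sub>n\<^sub>+\<^sub>1\<close> for every \<open>n \<ge> 1\<close>: it is the direct sum of the identity on a line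
  and a forward weighted shift. The vector \<open>x = e\<^sub>0 + e\<^sub>1\<close> is cyclic as soon as the norms of
  \<open>T\<^sup>m e\<^sub>1\<close> come arbitrarily close to \<open>0\<close>, because then \<open>T\<^sup>m x = e\<^sub>0 + T\<^sup>m e\<^sub>1\<close>
  accumulates at \<open>e\<^sub>0\<close>, and subtracting \<open>e\<^sub>0\<close> from the orbit recovers all the other
  exponentials. The quantitative form of this remark is \<open>identity_plus_shift_approximation\<close>.

  The norm of \<open>T\<^sup>m e\<^sub>1\<close> is
  \<open>\<beta> (m + 1) * exp (- Re b * (\<Lambda> (m + 1) - \<Lambda> 1) / (a - 1))\<close>. By definition of the lower limit
  \<open>\<beta>\<^sub>*\<close>, the weight \<open>\<beta> n\<close> is below \<open>exp (q * \<Lambda> n)\<close> for infinitely many \<open>n\<close>, for any fixed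
  \<open>q > \<beta>\<^sub>*\<close>; hence these norms have lower limit \<open>0\<close> whenever \<open>Re b > (a - 1) * \<beta>\<^sub>*\<close>
  (\<open>shift_orbit_frequently_small\<close>). This inequality follows from \<open>Re b > a * \<beta>\<^sub>*\<close> if
  \<open>\<beta>\<^sub>* \<ge> 0\<close> and from \<open>Re b \<ge> 0\<close> if \<open>\<beta>\<^sub>* < 0\<close>.

  Both the norm, which is defined through the coefficients of a function, and the explicit form of
  the frequencies, which needs \<open>\<Lambda>\<close> to be closed under multiplication by \<open>a\<close>, rest on the
  asymptotics of a Dirichlet series along the positive real axis
  (\<open>dirichlet_series_leading_term\<close>).
\<close>

section \<open>Uniqueness of the coefficients\<close>

lemma freq_limsup_finite_log_bound:
  assumes "filterlim \<Lambda> at_top sequentially" and "freq_limsup \<Lambda> < \<infinity>"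
  obtains M where "M > 0" "eventually (\<lambda>n. ln (real (Suc n)) \<le> M * \<Lambda> n) sequentially"
proof -
  obtain M0 :: real where "freq_limsup \<Lambda> < ereal M0"
    using assms(2) by (metis ereal_dense2)
  then have "freq_limsup \<Lambda> < ereal (max 1 M0)"
    by (metis ereal_less_eq(3) max.cobounded2 order_less_le_trans)
  then have "eventually (\<lambda>n. ereal (ln (real (Suc n)) / \<Lambda> n) < ereal (max 1 M0)) sequentially"
    unfolding freq_limsup_def by (rule Limsup_lessD)
  moreover have "eventually (\<lambda>n. \<Lambda> n > 0) sequentially"
    using assms(1) by (rule filterlim_at_top_dense[THEN iffD1, rule_format])
  ultimately have "eventually (\<lambda>n. ln (real (Suc n)) \<le> max 1 M0 * \<Lambda> n) sequentially"
    by eventually_elim (simp add: pos_divide_less_eq flip: ereal_max)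
  then show ?thesis
    by (intro that[of "max 1 M0"]) auto
qed

text \<open>
  Far to the right, a Dirichlet series is dominated by its first non-zero term. Convergence at a
  single point \<open>x\<^sub>0\<close> bounds the terms there; as \<open>log n\<close> is at most \<open>M * \<Lambda> n\<close> eventually,
  moving by \<open>2 * M\<close> to the right gains a factor \<open>1 / n\<^sup>2\<close> and hence absolute convergence.
  From there on, all terms after the \<open>k\<close>-th decay relative to it at least as fast as
  the gap between \<open>\<Lambda> k\<close> and the next frequency dictates, uniformly in the term.
\<close>

lemma dirichlet_series_leading_term:
  fixes f :: "real \<Rightarrow> complex" and c :: "nat \<Rightarrow> complex"
  assumes mono: "strict_mono \<Lambda>" and top: "filterlim \<Lambda> at_top sequentially"
    and fin: "freq_limsup \<Lambda> < \<infinity>"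
    and sums: "\<And>x. x > r \<Longrightarrow> (\<lambda>n. c n * exp (- (of_real (\<Lambda> n) * of_real x))) sums f x"
    and zero: "\<And>m. m < k \<Longrightarrow> c m = 0"
  shows "((\<lambda>x. f x * exp (of_real (\<Lambda> k) * of_real x)) \<longlongrightarrow> c k) at_top"
proof -
  obtain M where M: "M > 0" "eventually (\<lambda>n. ln (real (Suc n)) \<le> M * \<Lambda> n) sequentially"
    using freq_limsup_finite_log_bound[OF top fin] .
  define x0 where "x0 = r + 1"
  define x1 where "x1 = x0 + 2 * M"
  define h where "h n = cmod (c n) * exp (- ((\<Lambda> n - \<Lambda> k) * x1))" for n
  define \<delta> where "\<delta> = \<Lambda> (Suc k) - \<Lambda> k"
  have "\<delta> > 0" using mono by (simp add: \<delta>_def strict_mono_less)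
  have "Bseq (\<lambda>n. c n * exp (- (of_real (\<Lambda> n) * of_real x0)))"
    using sums[of x0] by (intro convergent_imp_Bseq)
      (auto simp: x0_def convergent_def dest!: sums_summable summable_LIMSEQ_zero)
  then obtain B where B: "\<And>n. cmod (c n * exp (- (of_real (\<Lambda> n) * of_real x0))) \<le> B"
    by (auto simp: Bseq_def)
  have B': "cmod (c n) * exp (- (\<Lambda> n * x0)) \<le> B" for n
    using B[of n] by (simp add: norm_mult)
  have "summable h"
  proof (rule summable_comparison_test_ev)
    show "eventually (\<lambda>n. norm (h n) \<le> B * exp (\<Lambda> k * x1) * (1 / real (Suc n) ^ 2)) sequentially"
      using M(2)
    proof eventually_elim
      case (elim n)
      have "h n = cmod (c n) * exp (- (\<Lambda> n * x0)) * exp (\<Lambda> k * x1) * exp (- (2 * (M * \<Lambda> n)))"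
        by (simp add: h_def x1_def algebra_simps flip: exp_add)
      also have "\<dots> \<le> B * exp (\<Lambda> k * x1) * exp (- (2 * ln (real (Suc n))))"
        using elim B'[of n] order_trans[OF mult_nonneg_nonneg B'[of 0]]
        by (intro mult_mono) auto
      also have "exp (- (2 * ln (real (Suc n)))) = 1 / real (Suc n) ^ 2"
        by (simp only: exp_minus exp_double exp_ln of_nat_0_less_iff zero_less_Suc inverse_eq_divide)
      finally show ?case by (simp add: h_def)
    qed
    have "summable (\<lambda>n. 1 / real (Suc n) ^ 2)"
      using inverse_squares_sums by (rule sums_summable[THEN summable_cong[THEN iffD1, rotated]]) simp
    then show "summable (\<lambda>n. B * exp (\<Lambda> k * x1) * (1 / real (Suc n) ^ 2))"
      by (rule summable_mult)
  qed
  have bound: "norm (f x * exp (of_real (\<Lambda> k) * of_real x) - c k)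
      \<le> suminf h * exp (- (\<delta> * (x - x1)))" if "x \<ge> x1" for x
  proof -
    let ?g = "\<lambda>n. c n * exp (- (of_real (\<Lambda> n) * of_real x)) * exp (of_real (\<Lambda> k) * of_real x)
      - (if n = k then c k else 0)"
    have "x > r" using that M(1) by (simp add: x1_def x0_def)
    then have g: "?g sums (f x * exp (of_real (\<Lambda> k) * of_real x) - c k)"
      by (intro sums_diff sums_mult2 sums sums_single)
    have le: "norm (?g n) \<le> h n * exp (- (\<delta> * (x - x1)))" for n
    proof -
      consider "n < k" | "n = k" | "n > k" by linarith
      then show ?thesis
      proof cases
        case 1
        then show ?thesis by (simp add: zero h_def)
      next
        case 2
        then have "?g n = 0" by (simp add: mult.assoc flip: exp_add)
        then show ?thesis by (simp add: h_def)
      next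
        case 3
        then have "\<Lambda> n \<ge> \<Lambda> (Suc k)"
          using mono by (simp add: strict_mono_less_eq)
        then have "(\<Lambda> n - \<Lambda> k) * (x - x1) \<ge> \<delta> * (x - x1)"
          using that by (intro mult_right_mono) (auto simp: \<delta>_def)
        moreover have "norm (?g n) = h n * exp (- ((\<Lambda> n - \<Lambda> k) * (x - x1)))"
          using 3 by (simp add: h_def norm_mult algebra_simps flip: exp_add)
        ultimately show ?thesis
          by (simp add: h_def mult_left_mono)
      qed
    qed
    have "norm (suminf ?g) \<le> (\<Sum>n. h n * exp (- (\<delta> * (x - x1))))"
      by (rule norm_suminf_le[OF le summable_mult2[OF \<open>summable h\<close>]])
    then show ?thesis
      using sums_unique[OF g] suminf_mult2[OF \<open>summable h\<close>] by simp
  qed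
  have "((\<lambda>x. suminf h * exp (- (\<delta> * (x - x1)))) \<longlongrightarrow> suminf h * 0) at_top"
  proof (intro tendsto_intros)
    have "filterlim (\<lambda>x. \<delta> * (- x1 + x)) at_top at_top"
      using \<open>\<delta> > 0\<close>
      by (intro filterlim_tendsto_pos_mult_at_top[OF tendsto_const]
          filterlim_tendsto_add_at_top[OF tendsto_const filterlim_ident])
    then have "filterlim (\<lambda>x. - (\<delta> * (x - x1))) at_bot at_top"
      by (simp add: filterlim_uminus_at_bot)
    then show "((\<lambda>x. exp (- (\<delta> * (x - x1)))) \<longlongrightarrow> 0) at_top"
      by (rule filterlim_compose[OF exp_at_bot])
  qed
  then have "((\<lambda>x. suminf h * exp (- (\<delta> * (x - x1)))) \<longlongrightarrow> 0) at_top" by simp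
  then have "((\<lambda>x. f x * exp (of_real (\<Lambda> k) * of_real x) - c k) \<longlongrightarrow> 0) at_top"
    by (rule Lim_null_comparison[rotated])
      (use bound in \<open>auto simp: eventually_at_top_linorder intro!: exI[of _ x1]\<close>)
  then show ?thesis by (simp add: LIM_zero_iff)
qed

lemma dirichlet_expansion_sums_real:
  assumes "dirichlet_expansion \<beta> \<Lambda> c f"
    and "x > real_of_ereal (freq_limsup \<Lambda>) / 2 - real_of_ereal (weight_liminf \<beta> \<Lambda>)"
  shows "(\<lambda>n. c n * exp (- (of_real (\<Lambda> n) * of_real x))) sums f (of_real x)"
  using assms by (auto simp: dirichlet_expansion_def dirichlet_domain_def half_plane_def)

lemma dirichlet_expansion_add:
  assumes "dirichlet_expansion \<beta> \<Lambda> c f" "dirichlet_expansion \<beta> \<Lambda> d g"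
  shows "dirichlet_expansion \<beta> \<Lambda> (c + d) (f + g)"
proof -
  have "summable (\<lambda>n. (cmod (c n + d n))\<^sup>2 * (\<beta> n)\<^sup>2)"
  proof (rule summable_comparison_test')
    show "summable (\<lambda>n. 2 * ((cmod (c n))\<^sup>2 * (\<beta> n)\<^sup>2) + 2 * ((cmod (d n))\<^sup>2 * (\<beta> n)\<^sup>2))"
      using assms by (intro summable_add summable_mult) (auto simp: dirichlet_expansion_def)
    fix n
    have "(cmod (c n + d n))\<^sup>2 \<le> (cmod (c n) + cmod (d n))\<^sup>2"
      by (intro power_mono norm_triangle_ineq) auto
    also have "\<dots> \<le> 2 * (cmod (c n))\<^sup>2 + 2 * (cmod (d n))\<^sup>2"
      using sum_squares_bound[of "cmod (c n)" "cmod (d n)"] by (simp add: power2_sum)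
    finally show "norm ((cmod (c n + d n))\<^sup>2 * (\<beta> n)\<^sup>2)
        \<le> 2 * ((cmod (c n))\<^sup>2 * (\<beta> n)\<^sup>2) + 2 * ((cmod (d n))\<^sup>2 * (\<beta> n)\<^sup>2)"
      by (simp add: mult_right_mono flip: distrib_right mult.assoc)
  qed
  then show ?thesis
    using assms by (auto simp: dirichlet_expansion_def distrib_right intro!: sums_add)
qed

lemma dirichlet_expansion_scale:
  assumes "dirichlet_expansion \<beta> \<Lambda> c f"
  shows "dirichlet_expansion \<beta> \<Lambda> (fun_scale s c) (fun_scale s f)"
  using assms
  by (auto simp: dirichlet_expansion_def fun_scale_def norm_mult power_mult_distrib mult.assoc
      intro!: sums_mult summable_mult)

lemma dirichlet_expansion_diff:
  assumes "dirichlet_expansion \<beta> \<Lambda> c f" "dirichlet_expansion \<beta> \<Lambda> d g"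
  shows "dirichlet_expansion \<beta> \<Lambda> (c - d) (f - g)"
proof -
  have "c + fun_scale (-1) d = c - d" "f + fun_scale (-1) g = f - g"
    by (auto simp: fun_eq_iff fun_scale_def)
  then show ?thesis
    using dirichlet_expansion_add[OF assms(1) dirichlet_expansion_scale[OF assms(2), of "-1"]] by simp
qed

lemma dirichlet_expansion_sum:
  assumes "\<And>i. i \<in> I \<Longrightarrow> dirichlet_expansion \<beta> \<Lambda> (C i) (F i)"
  shows "dirichlet_expansion \<beta> \<Lambda> (\<Sum>i\<in>I. C i) (\<Sum>i\<in>I. F i)"
  using assms
proof (induction I rule: infinite_finite_induct)
  case (insert i I)
  show ?case
    unfolding sum.insert[OF insert.hyps]
    by (intro dirichlet_expansion_add insert) auto
qed (auto simp: dirichlet_expansion_def)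

text \<open>
  The growth rates at \<open>+\<infinity>\<close> of the exponential and of the leading term of its expansion have to
  agree, so the frequency of the exponential is the one of the leading term.
\<close>

lemma dirichlet_expansion_exp_frequency:
  assumes mono: "strict_mono \<Lambda>" and top: "filterlim \<Lambda> at_top sequentially"
    and fin: "freq_limsup \<Lambda> < \<infinity>"
    and exp: "dirichlet_expansion \<beta> \<Lambda> c f"
    and f: "\<And>z. z \<in> dirichlet_domain \<beta> \<Lambda> \<Longrightarrow> f z = s * exp (- (of_real \<mu> * z))"
    and "s \<noteq> 0"
  shows "\<exists>m. \<Lambda> m = \<mu>"
proof -
  let ?r = "real_of_ereal (freq_limsup \<Lambda>) / 2 - real_of_ereal (weight_liminf \<beta> \<Lambda>)"
  have fx: "f (of_real x) = s * exp (- (of_real \<mu> * of_real x))" if "x > ?r" for x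
    using that f[of "of_real x"] by (auto simp: dirichlet_domain_def half_plane_def)
  have "\<exists>n. c n \<noteq> 0"
  proof (rule ccontr)
    assume "\<not> ?thesis"
    then have "f (of_real (?r + 1)) = 0"
      using dirichlet_expansion_sums_real[OF exp, of "?r + 1"] by (simp add: sums_0 sums_unique2)
    then show False using fx[of "?r + 1"] \<open>s \<noteq> 0\<close> by simp
  qed
  define k where "k = (LEAST n. c n \<noteq> 0)"
  have ck: "c k \<noteq> 0" and below: "\<And>m. m < k \<Longrightarrow> c m = 0"
    using LeastI_ex[OF \<open>\<exists>n. c n \<noteq> 0\<close>] not_less_Least[of _ "\<lambda>n. c n \<noteq> 0"]
    unfolding k_def by blast+
  have "((\<lambda>x. f (of_real x) * exp (of_real (\<Lambda> k) * of_real x)) \<longlongrightarrow> c k) at_top"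
    using dirichlet_series_leading_term[OF mono top fin dirichlet_expansion_sums_real[OF exp] below] .
  moreover have "eventually (\<lambda>x. f (of_real x) * exp (of_real (\<Lambda> k) * of_real x)
      = s * of_real (exp ((\<Lambda> k - \<mu>) * x))) at_top"
    using eventually_gt_at_top[of ?r]
  proof eventually_elim
    case (elim x)
    then show ?case
      by (simp add: fx mult.assoc exp_of_real[symmetric] algebra_simps flip: exp_add)
  qed
  ultimately have "((\<lambda>x. s * of_real (exp ((\<Lambda> k - \<mu>) * x))) \<longlongrightarrow> c k) at_top"
    by (rule Lim_transform_eventually)
  then have "((\<lambda>x. norm (s * of_real (exp ((\<Lambda> k - \<mu>) * x))) / norm s) \<longlongrightarrow> norm (c k) / norm s) at_top"
    using \<open>s \<noteq> 0\<close> by (intro tendsto_intros) auto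
  then have lim: "((\<lambda>x. exp ((\<Lambda> k - \<mu>) * x)) \<longlongrightarrow> norm (c k) / norm s) at_top"
    using \<open>s \<noteq> 0\<close> by (simp add: norm_mult)
  have "norm (c k) / norm s \<noteq> 0" using ck \<open>s \<noteq> 0\<close> by simp
  consider "\<Lambda> k = \<mu>" | "\<Lambda> k > \<mu>" | "\<Lambda> k < \<mu>" by linarith
  then have "\<Lambda> k = \<mu>"
  proof cases
    case 2
    then have "filterlim (\<lambda>x. exp ((\<Lambda> k - \<mu>) * x)) at_top at_top"
      by (intro filterlim_compose[OF exp_at_top] filterlim_tendsto_pos_mult_at_top[OF tendsto_const]
            filterlim_ident) auto
    then show ?thesis
      using lim not_tendsto_and_filterlim_at_infinity[OF _ lim]
      by (simp add: filterlim_at_top_imp_at_infinity)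
  next
    case 3
    then have "((\<lambda>x. exp ((\<Lambda> k - \<mu>) * x)) \<longlongrightarrow> 0) at_top"
      by (intro filterlim_compose[OF exp_at_bot] filterlim_tendsto_neg_mult_at_bot[OF tendsto_const]
            filterlim_ident) auto
    then show ?thesis
      using tendsto_unique[OF _ lim] \<open>norm (c k) / norm s \<noteq> 0\<close> by auto
  qed
  then show ?thesis ..
qed

text \<open>
  All coefficients of an expansion of the zero function vanish, one after the other, since each is
  the limit that describes the leading term.
\<close>

lemma dirichlet_expansion_unique:
  assumes mono: "strict_mono \<Lambda>" and top: "filterlim \<Lambda> at_top sequentially"
    and fin: "freq_limsup \<Lambda> < \<infinity>"
    and c: "dirichlet_expansion \<beta> \<Lambda> c f" and d: "dirichlet_expansion \<beta> \<Lambda> d f"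
  shows "c = d"
proof -
  have exp: "dirichlet_expansion \<beta> \<Lambda> (c - d) (f - f)"
    using c d by (rule dirichlet_expansion_diff)
  have "(c - d) k = 0" for k
  proof (induction k rule: less_induct)
    case (less k)
    have "((\<lambda>x::real. (f - f) (of_real x) * exp (of_real (\<Lambda> k) * of_real x)) \<longlongrightarrow> (c - d) k) at_top"
      using dirichlet_series_leading_term[OF mono top fin dirichlet_expansion_sums_real[OF exp] less] .
    then have "((\<lambda>x::real. 0 :: complex) \<longlongrightarrow> (c - d) k) at_top" by simp
    then show ?case
      by (metis tendsto_const tendsto_unique trivial_limit_at_top_linorder)
  qed
  then show ?thesis by (auto simp: fun_eq_iff)
qed

lemma dirichlet_norm_expansion:
  assumes mono: "strict_mono \<Lambda>" and top: "filterlim \<Lambda> at_top sequentially"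
    and fin: "freq_limsup \<Lambda> < \<infinity>"
    and c: "dirichlet_expansion \<beta> \<Lambda> c f"
  shows "dirichlet_norm \<beta> \<Lambda> f = sqrt (\<Sum>n. (cmod (c n))\<^sup>2 * (\<beta> n)\<^sup>2)"
proof -
  have "dirichlet_coeff \<beta> \<Lambda> f = c"
    unfolding dirichlet_coeff_def
    using c dirichlet_expansion_unique[OF mono top fin _ c] by blast
  moreover have "summable (\<lambda>n. (cmod (c n))\<^sup>2 * (\<beta> n)\<^sup>2)"
    using c by (simp add: dirichlet_expansion_def)
  then have "(\<Sum>n. complex_of_real ((cmod (c n))\<^sup>2 * (\<beta> n)\<^sup>2)) = of_real (\<Sum>n. (cmod (c n))\<^sup>2 * (\<beta> n)\<^sup>2)"
    by (rule suminf_of_real[symmetric])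
  then have "(\<Sum>n. c n * cnj (c n) * of_real ((\<beta> n)\<^sup>2)) = of_real (\<Sum>n. (cmod (c n))\<^sup>2 * (\<beta> n)\<^sup>2)"
    by (simp only: of_real_mult complex_norm_square)
  ultimately show ?thesis
    by (simp add: dirichlet_norm_def dirichlet_inner_def)
qed

section \<open>The operator as a direct sum of the identity and a weighted shift\<close>

definition dirichlet_monomial :: "(nat \<Rightarrow> real) \<Rightarrow> (nat \<Rightarrow> real) \<Rightarrow> nat \<Rightarrow> complex \<Rightarrow> complex" where
  "dirichlet_monomial \<beta> \<Lambda> k =
     (\<lambda>z. if z \<in> dirichlet_domain \<beta> \<Lambda> then exp (- (of_real (\<Lambda> k) * z)) else 0)"

lemma dirichlet_expansion_monomial:
  "dirichlet_expansion \<beta> \<Lambda> (\<lambda>n. if n = k then 1 else 0) (dirichlet_monomial \<beta> \<Lambda> k)"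
proof -
  have "summable (\<lambda>n. (cmod (if n = k then 1 else 0))\<^sup>2 * (\<beta> n)\<^sup>2)"
    by (rule summable_finite[of "{k}"]) auto
  moreover have "(\<lambda>n. (if n = k then 1 else 0) * exp (- (of_real (\<Lambda> n) * z)))
      sums exp (- (of_real (\<Lambda> k) * z))" for z :: complex
    using sums_single[of k "\<lambda>n. exp (- (of_real (\<Lambda> n) * z))"]
    by (rule sums_cong[THEN iffD1, rotated]) auto
  ultimately show ?thesis
    by (auto simp: dirichlet_expansion_def dirichlet_monomial_def)
qed

lemma dirichlet_monomial_in_space: "dirichlet_monomial \<beta> \<Lambda> k \<in> dirichlet_space \<beta> \<Lambda>"
  using dirichlet_expansion_monomial
  by (fastforce simp: dirichlet_space_def dirichlet_monomial_def)

text \<open>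
  The operator sends the exponential with frequency \<open>\<Lambda> n\<close> to a multiple of the one with
  frequency \<open>a * \<Lambda> n\<close>, which can lie in the space only if this is again one of the frequencies.
\<close>

lemma frequencies_closed_under_dilation:
  assumes mono: "strict_mono \<Lambda>" and top: "filterlim \<Lambda> at_top sequentially"
    and fin: "freq_limsup \<Lambda> < \<infinity>"
    and bdd: "bounded_comp_op \<beta> \<Lambda> (\<lambda>z. of_real a * z + b)"
  shows "\<exists>m. \<Lambda> m = a * \<Lambda> n"
proof -
  let ?\<phi> = "\<lambda>z. of_real a * z + b"
  let ?f = "comp_op \<beta> \<Lambda> ?\<phi> (dirichlet_monomial \<beta> \<Lambda> n)"
  have "?f \<in> dirichlet_space \<beta> \<Lambda>"
    using bdd dirichlet_monomial_in_space by (auto simp: bounded_comp_op_def)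
  then obtain c where "dirichlet_expansion \<beta> \<Lambda> c ?f"
    by (auto simp: dirichlet_space_def)
  moreover have "?f z = exp (- (of_real (\<Lambda> n) * b)) * exp (- (of_real (a * \<Lambda> n) * z))"
    if "z \<in> dirichlet_domain \<beta> \<Lambda>" for z
    using that bdd
    by (auto simp: comp_op_def dirichlet_monomial_def bounded_comp_op_def algebra_simps
        simp flip: exp_add)
  ultimately show ?thesis
    by (rule dirichlet_expansion_exp_frequency[OF mono top fin]) auto
qed

text \<open>
  The factors \<open>exp (- b * \<Lambda> i)\<close> with \<open>1 \<le> i \<le> m\<close> that arise when the operator is applied
  \<open>m\<close> times to \<open>e\<^sub>1\<close> multiply to this closed form, because
  \<open>(a - 1) * \<Lambda> i = \<Lambda> (i + 1) - \<Lambda> i\<close> makes the sum of their exponents telescope.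
\<close>

definition shift_weight :: "(nat \<Rightarrow> real) \<Rightarrow> real \<Rightarrow> complex \<Rightarrow> nat \<Rightarrow> complex" where
  "shift_weight \<Lambda> a b m = exp (- (b * of_real ((\<Lambda> (Suc m) - \<Lambda> 1) / (a - 1))))"

lemma comp_op_orbit:
  assumes zero: "\<Lambda> 0 = 0" and geom: "\<And>n. \<Lambda> (Suc n) = \<Lambda> 1 * a ^ n" and "a > 1"
    and maps: "(\<lambda>z. of_real a * z + b) ` dirichlet_domain \<beta> \<Lambda> \<subseteq> dirichlet_domain \<beta> \<Lambda>"
  shows "(comp_op \<beta> \<Lambda> (\<lambda>z. of_real a * z + b) ^^ m)
      (dirichlet_monomial \<beta> \<Lambda> 0 + dirichlet_monomial \<beta> \<Lambda> 1)
    = dirichlet_monomial \<beta> \<Lambda> 0 + fun_scale (shift_weight \<Lambda> a b m) (dirichlet_monomial \<beta> \<Lambda> (Suc m))"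
proof (induction m)
  case 0
  show ?case by (simp add: shift_weight_def fun_scale_def)
next
  case (Suc m)
  have step: "\<Lambda> (Suc (Suc m)) = a * \<Lambda> (Suc m)"
    using geom[of m] geom[of "Suc m"] by simp
  have "(\<Lambda> (Suc (Suc m)) - \<Lambda> 1) / (a - 1) = (\<Lambda> (Suc m) - \<Lambda> 1) / (a - 1) + \<Lambda> (Suc m)"
    using \<open>a > 1\<close> by (simp add: step field_simps)
  then have w: "shift_weight \<Lambda> a b (Suc m) = shift_weight \<Lambda> a b m * exp (- (of_real (\<Lambda> (Suc m)) * b))"
    by (simp add: shift_weight_def algebra_simps flip: exp_add)
  show ?case
    unfolding funpow.simps comp_apply Suc.IH w
  proof (rule ext)
    fix z
    have "shift_weight \<Lambda> a b m * exp (- (of_real (\<Lambda> (Suc m)) * (of_real a * z + b)))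
      = shift_weight \<Lambda> a b m * exp (- (of_real (\<Lambda> (Suc m)) * b))
          * exp (- (of_real (\<Lambda> (Suc (Suc m))) * z))"
      by (simp add: step mult.assoc algebra_simps flip: exp_add)
    then show "comp_op \<beta> \<Lambda> (\<lambda>z. of_real a * z + b)
        (dirichlet_monomial \<beta> \<Lambda> 0 + fun_scale (shift_weight \<Lambda> a b m) (dirichlet_monomial \<beta> \<Lambda> (Suc m))) z
      = (dirichlet_monomial \<beta> \<Lambda> 0 + fun_scale (shift_weight \<Lambda> a b m *
          exp (- (of_real (\<Lambda> (Suc m)) * b))) (dirichlet_monomial \<beta> \<Lambda> (Suc (Suc m)))) z"
      using maps by (auto simp: comp_op_def fun_scale_def dirichlet_monomial_def zero)
  qed
qed

section \<open>The shift orbit comes arbitrarily close to zero\<close>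

text \<open>
  If \<open>q\<close> lies strictly between \<open>\<beta>\<^sub>*\<close> and \<open>Re b / (a - 1)\<close>, then \<open>\<beta> n < exp (q * \<Lambda> n)\<close> holds
  for infinitely many \<open>n\<close>, and for these the norm is at most a constant times
  \<open>exp (- (Re b / (a - 1) - q) * \<Lambda> n)\<close>. Smallness is available only along such \<open>n\<close>, which is
  enough for the purpose of approximating \<open>e\<^sub>0\<close>.
\<close>

lemma shift_orbit_frequently_small:
  assumes mono: "strict_mono \<Lambda>" and zero: "\<Lambda> 0 = 0" and top: "filterlim \<Lambda> at_top sequentially"
    and pos: "\<And>n. \<beta> n > 0" and fin: "weight_liminf \<beta> \<Lambda> \<noteq> \<infinity>" "weight_liminf \<beta> \<Lambda> \<noteq> -\<infinity>"
    and a: "a > 1" and b: "Re b > (a - 1) * real_of_ereal (weight_liminf \<beta> \<Lambda>)"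
    and "\<epsilon> > 0"
  shows "\<exists>m\<ge>N. cmod (shift_weight \<Lambda> a b m) * \<beta> (Suc m) < \<epsilon>"
proof -
  let ?l = "real_of_ereal (weight_liminf \<beta> \<Lambda>)"
  have "?l < Re b / (a - 1)"
    using a b by (simp add: field_simps)
  then obtain q where q: "?l < q" "q < Re b / (a - 1)"
    using dense by blast
  define \<delta> where "\<delta> = Re b / (a - 1) - q"
  have "\<delta> > 0" using q by (simp add: \<delta>_def)
  have "weight_liminf \<beta> \<Lambda> < ereal q"
    using q(1) fin by (cases "weight_liminf \<beta> \<Lambda>") auto
  then have freq: "\<exists>\<^sub>F n in sequentially. ln (\<beta> n) / \<Lambda> n < q"
    unfolding weight_liminf_def
    by (metis (mono_tags, lifting) Liminf_bounded eventually_mono ereal_less_eq(3) frequently_def not_less)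
  have "((\<lambda>n. exp (- (\<delta> * \<Lambda> n) + Re b * \<Lambda> 1 / (a - 1))) \<longlonglongrightarrow> 0)"
  proof (rule filterlim_compose[OF exp_at_bot])
    have "filterlim (\<lambda>n. \<delta> * \<Lambda> n) at_top sequentially"
      using \<open>\<delta> > 0\<close> by (intro filterlim_tendsto_pos_mult_at_top[OF tendsto_const] top) auto
    then have "filterlim (\<lambda>n. - (Re b * \<Lambda> 1 / (a - 1)) + \<delta> * \<Lambda> n) at_top sequentially"
      by (intro filterlim_tendsto_add_at_top[OF tendsto_const])
    then show "filterlim (\<lambda>n. - (\<delta> * \<Lambda> n) + Re b * \<Lambda> 1 / (a - 1)) at_bot sequentially"
      by (simp add: filterlim_uminus_at_bot algebra_simps)
  qed
  then have "\<forall>\<^sub>F n in sequentially. exp (- (\<delta> * \<Lambda> n) + Re b * \<Lambda> 1 / (a - 1)) < \<epsilon>"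
    using \<open>\<epsilon> > 0\<close> by (rule order_tendstoD)
  then have "\<forall>\<^sub>F n in sequentially. exp (- (\<delta> * \<Lambda> n) + Re b * \<Lambda> 1 / (a - 1)) < \<epsilon> \<and> n \<ge> Suc N"
    using eventually_ge_at_top by (rule eventually_conj)
  with freq have "\<exists>\<^sub>F n in sequentially. ln (\<beta> n) / \<Lambda> n < q \<and>
      exp (- (\<delta> * \<Lambda> n) + Re b * \<Lambda> 1 / (a - 1)) < \<epsilon> \<and> n \<ge> Suc N"
    by (rule frequently_rev_mp[OF _ eventually_mono]) auto
  then obtain n where n: "ln (\<beta> n) / \<Lambda> n < q"
      "exp (- (\<delta> * \<Lambda> n) + Re b * \<Lambda> 1 / (a - 1)) < \<epsilon>" "n \<ge> Suc N"
    by (blast dest: frequently_ex)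
  then obtain m where m: "n = Suc m" "m \<ge> N" by (cases n) auto
  have "\<Lambda> n > 0" using mono zero m(1) by (metis strict_mono_less zero_less_Suc)
  then have "ln (\<beta> n) < q * \<Lambda> n" using n(1) by (simp add: field_simps)
  have "cmod (shift_weight \<Lambda> a b m) * \<beta> (Suc m)
      = exp (- (Re b * ((\<Lambda> n - \<Lambda> 1) / (a - 1))) + ln (\<beta> n))"
    using pos[of n] by (simp only: exp_add exp_ln) (simp add: shift_weight_def m(1))
  also have "\<dots> < exp (- (\<delta> * \<Lambda> n) + Re b * \<Lambda> 1 / (a - 1))"
    using \<open>ln (\<beta> n) < q * \<Lambda> n\<close> by (simp add: \<delta>_def algebra_simps diff_divide_distrib)
  also have "\<dots> < \<epsilon>" by (rule n(2))
  finally show ?thesis using m(2) by blast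
qed

section \<open>Cyclicity\<close>

text \<open>
  This is the cyclicity argument in coordinates, where \<open>v m\<close> is the \<open>m\<close>-th orbit vector
  \<open>e\<^sub>0 + w m e\<^sub>m\<^sub>+\<^sub>1\<close>. The orbit vectors with \<open>m < N\<close> match the coordinates \<open>1, \<dots>, N\<close> of \<open>y\<close>
  exactly, which leaves a defect \<open>D\<close> in coordinate \<open>0\<close>. A multiple of one more orbit vector,
  taken so late that its shift part is small even after multiplication by \<open>D\<close>, repairs it.
  The error consists of the tail of \<open>y\<close> and of that small shift part.
\<close>

lemma identity_plus_shift_approximation:
  fixes y w :: "nat \<Rightarrow> complex" and \<beta> :: "nat \<Rightarrow> real"
  defines "v \<equiv> \<lambda>m n. if n = 0 then 1 else if n = Suc m then w m else 0"
  assumes summ: "summable (\<lambda>n. (cmod (y n))\<^sup>2 * (\<beta> n)\<^sup>2)"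
    and nz: "\<And>m. w m \<noteq> 0"
    and small: "\<And>\<epsilon> N. \<epsilon> > 0 \<Longrightarrow> \<exists>m\<ge>N. cmod (w m) * \<bar>\<beta> (Suc m)\<bar> < \<epsilon>"
    and "e > 0"
  shows "\<exists>N s. (\<Sum>n. (cmod (y n - (\<Sum>i<N. s i * v i n)))\<^sup>2 * (\<beta> n)\<^sup>2) < e\<^sup>2"
proof -
  define t where "t n = (cmod (y n))\<^sup>2 * (\<beta> n)\<^sup>2" for n
  have t: "t sums suminf t" using summ by (simp add: t_def[abs_def] summable_sums)
  then have "(\<lambda>N. \<Sum>n\<le>N. t n) \<longlonglongrightarrow> suminf t" by (simp add: sums_def_le)
  then have "\<forall>\<^sub>F N in sequentially. (\<Sum>n\<le>N. t n) > suminf t - e\<^sup>2 / 4"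
    using \<open>e > 0\<close> by (intro order_tendstoD) auto
  then obtain N where N: "(\<Sum>n\<le>N. t n) > suminf t - e\<^sup>2 / 4"
    by (auto simp: eventually_at_top_linorder)
  define d where "d i = y (Suc i) / w i" for i
  define D where "D = y 0 - (\<Sum>i<N. d i)"
  \<comment> \<open>The summand \<open>1\<close> keeps the tolerance meaningful when the defect \<open>D\<close> is zero.\<close>
  obtain M where M: "M \<ge> N" "cmod (w M) * \<bar>\<beta> (Suc M)\<bar> < e / (2 * (cmod D + 1))"
    using small[of "e / (2 * (cmod D + 1))" N] \<open>e > 0\<close> by (auto simp: add_nonneg_pos)
  define s where "s i = (if i < N then d i else if i = M then D else 0)" for i
  have coeff: "(\<Sum>i<Suc M. s i * v i n) = (\<Sum>i<N. d i * v i n) + D * v M n" for n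
  proof -
    have "(\<Sum>i<Suc M. s i * v i n) = (\<Sum>i<M. s i * v i n) + D * v M n"
      using M(1) by (simp add: s_def)
    also have "(\<Sum>i<M. s i * v i n) = (\<Sum>i<N. d i * v i n)"
      using M(1) by (intro sum.mono_neutral_cong_right) (auto simp: s_def)
    finally show ?thesis .
  qed
  define E where "E = cmod (D * w M) * \<bar>\<beta> (Suc M)\<bar>"
  have "E \<le> e / 2"
  proof -
    have "E = cmod D * (cmod (w M) * \<bar>\<beta> (Suc M)\<bar>)" by (simp add: E_def norm_mult)
    also have "\<dots> \<le> (cmod D + 1) * (e / (2 * (cmod D + 1)))"
      using M(2) by (intro mult_mono) auto
    also have "\<dots> = e / 2"
      using add_nonneg_pos[OF norm_ge_zero[of D] zero_less_one] by (simp add: field_simps)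
    finally show ?thesis .
  qed
  then have E: "E\<^sup>2 \<le> e\<^sup>2 / 4"
    using power_mono[of E "e / 2" 2] by (simp add: E_def power_divide)
  define R where "R n = 2 * (t n - (if n \<in> {..N} then t n else 0))
      + 2 * (if n = Suc M then E\<^sup>2 else 0)" for n
  have R: "R sums (2 * (suminf t - (\<Sum>n\<le>N. t n)) + 2 * E\<^sup>2)"
    unfolding R_def by (intro sums_add sums_mult sums_diff t sums_If_finite_set sums_single) auto
  have le: "(cmod (y n - (\<Sum>i<Suc M. s i * v i n)))\<^sup>2 * (\<beta> n)\<^sup>2 \<le> R n" for n
  proof (cases n)
    case 0
    then have "y n - (\<Sum>i<Suc M. s i * v i n) = 0"
      by (simp add: coeff del: sum.lessThan_Suc) (simp add: v_def D_def)
    then show ?thesis by (simp add: R_def 0 del: sum.lessThan_Suc)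
  next
    case (Suc j)
    have sum: "(\<Sum>i<N. d i * v i n) = (if j < N then y n else 0)"
    proof -
      have "(\<Sum>i<N. d i * v i n) = (\<Sum>i<N. if i = j then y n else 0)"
        by (intro sum.cong) (auto simp: v_def Suc d_def nz)
      then show ?thesis by simp
    qed
    show ?thesis
    proof (cases "j < N")
      case True
      then show ?thesis
        using M(1) by (simp add: coeff sum R_def del: sum.lessThan_Suc) (simp add: v_def Suc)
    next
      case False
      have "y n - (\<Sum>i<Suc M. s i * v i n) = y n - (if n = Suc M then D * w M else 0)"
        using False by (simp add: coeff sum del: sum.lessThan_Suc) (simp add: v_def Suc)
      moreover have "(cmod (y n - x))\<^sup>2 * (\<beta> n)\<^sup>2 \<le> 2 * t n + 2 * ((cmod x)\<^sup>2 * (\<beta> n)\<^sup>2)" for x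
      proof -
        have "(cmod (y n - x))\<^sup>2 \<le> (cmod (y n) + cmod x)\<^sup>2"
          by (intro power_mono norm_triangle_ineq4) auto
        also have "\<dots> \<le> 2 * (cmod (y n))\<^sup>2 + 2 * (cmod x)\<^sup>2"
          using sum_squares_bound[of "cmod (y n)" "cmod x"] by (simp add: power2_sum)
        finally show ?thesis
          by (simp add: t_def mult_right_mono flip: distrib_right mult.assoc)
      qed
      from this[of "if n = Suc M then D * w M else 0"]
      have "(cmod (y n - (if n = Suc M then D * w M else 0)))\<^sup>2 * (\<beta> n)\<^sup>2 \<le> R n"
        using False by (auto simp: R_def Suc E_def power_mult_distrib)
      ultimately show ?thesis by (simp only:)
    qed
  qed
  have "summable (\<lambda>n. (cmod (y n - (\<Sum>i<Suc M. s i * v i n)))\<^sup>2 * (\<beta> n)\<^sup>2)"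
    by (rule summable_comparison_test'[OF sums_summable[OF R]]) (use le in auto)
  then have "(\<Sum>n. (cmod (y n - (\<Sum>i<Suc M. s i * v i n)))\<^sup>2 * (\<beta> n)\<^sup>2) \<le> suminf R"
    by (rule suminf_le[OF le _ sums_summable[OF R]])
  also have "\<dots> = 2 * (suminf t - (\<Sum>n\<le>N. t n)) + 2 * E\<^sup>2"
    using R by (rule sums_unique[symmetric])
  also have "\<dots> < e\<^sup>2" using N E by (simp add: field_simps)
  finally show ?thesis by blast
qed

theorem corollary5p17:
  fixes \<Lambda> \<beta> :: "nat \<Rightarrow> real" and a :: real and b :: complex
  assumes "strict_mono \<Lambda>" and "\<And>n. \<Lambda> n \<ge> 0" and "filterlim \<Lambda> at_top sequentially"
    and "freq_limsup \<Lambda> < \<infinity>"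
    and "\<And>n. \<beta> n > 0"
    and "weight_liminf \<beta> \<Lambda> \<noteq> \<infinity>" and "weight_liminf \<beta> \<Lambda> \<noteq> -\<infinity>"
    and "a > 1"
    and "one_zero_one_nonzero_initial a \<Lambda>"
    and "bounded_comp_op \<beta> \<Lambda> (\<lambda>z. of_real a * z + b)"
    and "Re b > a * real_of_ereal (weight_liminf \<beta> \<Lambda>)"
    and "Re b \<ge> 0"
  shows "cyclic_on (dirichlet_space \<beta> \<Lambda>) (dirichlet_norm \<beta> \<Lambda>)
           (comp_op \<beta> \<Lambda> (\<lambda>z. of_real a * z + b))"
proof -
  note uniq = \<open>strict_mono \<Lambda>\<close> \<open>filterlim \<Lambda> at_top sequentially\<close> \<open>freq_limsup \<Lambda> < \<infinity>\<close>
  let ?T = "comp_op \<beta> \<Lambda> (\<lambda>z. of_real a * z + b)"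
  let ?e = "dirichlet_monomial \<beta> \<Lambda>"
  let ?x = "?e 0 + ?e 1"
  let ?w = "shift_weight \<Lambda> a b"
  let ?v = "\<lambda>m n. if n = 0 then 1 else if n = Suc m then ?w m else 0"
  have "\<exists>m. \<Lambda> m = a * \<Lambda> n" for n
    using frequencies_closed_under_dilation[OF uniq] assms by blast
  then have zero: "\<Lambda> 0 = 0" and geom: "\<And>n. \<Lambda> (Suc n) = \<Lambda> 1 * a ^ n"
    using one_zero_one_nonzero_initial_iff[of \<Lambda> a] assms by blast+
  have orbit: "(?T ^^ m) ?x = ?e 0 + fun_scale (?w m) (?e (Suc m))" for m
    using comp_op_orbit[OF zero geom \<open>a > 1\<close>] assms unfolding bounded_comp_op_def by blast
  have "Re b > (a - 1) * real_of_ereal (weight_liminf \<beta> \<Lambda>)"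
  proof (cases "real_of_ereal (weight_liminf \<beta> \<Lambda>) \<ge> 0")
    case True
    then show ?thesis using assms(11) by (simp add: algebra_simps)
  next
    case False
    then have "(a - 1) * real_of_ereal (weight_liminf \<beta> \<Lambda>) < 0"
      using \<open>a > 1\<close> by (intro mult_pos_neg) auto
    then show ?thesis using \<open>Re b \<ge> 0\<close> by linarith
  qed
  then have small: "\<exists>m\<ge>N. cmod (?w m) * \<bar>\<beta> (Suc m)\<bar> < \<epsilon>" if "\<epsilon> > 0" for \<epsilon> N
    using shift_orbit_frequently_small[of \<Lambda> \<beta> a b \<epsilon> N] that zero assms
    by (simp add: less_imp_le)
  interpret vector_space "fun_scale :: complex \<Rightarrow> (complex \<Rightarrow> complex) \<Rightarrow> _"
    by (rule vector_space_fun_scale)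
  have orbit_coeff: "dirichlet_expansion \<beta> \<Lambda> (?v m) ((?T ^^ m) ?x)" for m
  proof -
    have "?v m = (\<lambda>n. if n = 0 then 1 else 0) + fun_scale (?w m) (\<lambda>n. if n = Suc m then 1 else 0)"
      by (auto simp: fun_eq_iff fun_scale_def)
    then show ?thesis
      unfolding orbit
      by (simp only: dirichlet_expansion_add dirichlet_expansion_scale dirichlet_expansion_monomial)
  qed
  have approx: "\<exists>u \<in> span (orbit_of ?T ?x). dirichlet_norm \<beta> \<Lambda> (f - u) < e"
    if f: "f \<in> dirichlet_space \<beta> \<Lambda>" and "e > 0" for f e
  proof -
    obtain y where y: "dirichlet_expansion \<beta> \<Lambda> y f"
      using f by (auto simp: dirichlet_space_def)
    then have "summable (\<lambda>n. (cmod (y n))\<^sup>2 * (\<beta> n)\<^sup>2)"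
      by (simp add: dirichlet_expansion_def)
    then obtain N s where
      less: "(\<Sum>n. (cmod (y n - (\<Sum>i<N. s i * ?v i n)))\<^sup>2 * (\<beta> n)\<^sup>2) < e\<^sup>2"
      using identity_plus_shift_approximation[of y \<beta> ?w e] small \<open>e > 0\<close>
      by (auto simp: shift_weight_def)
    define u where "u = (\<Sum>i<N. fun_scale (s i) ((?T ^^ i) ?x))"
    have "u \<in> span (orbit_of ?T ?x)"
      unfolding u_def by (intro span_sum span_scale span_base) (simp add: orbit_of_def)
    moreover have "dirichlet_expansion \<beta> \<Lambda> (y - (\<Sum>i<N. fun_scale (s i) (?v i))) (f - u)"
      unfolding u_def
      by (intro dirichlet_expansion_diff y dirichlet_expansion_sum dirichlet_expansion_scale orbit_coeff)
    moreover have "(\<Sum>i<N. fun_scale (s i) (?v i)) n = (\<Sum>i<N. s i * ?v i n)" for n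
      by (induction N) (auto simp: fun_scale_def)
    ultimately have "dirichlet_norm \<beta> \<Lambda> (f - u)
        = sqrt (\<Sum>n. (cmod (y n - (\<Sum>i<N. s i * ?v i n)))\<^sup>2 * (\<beta> n)\<^sup>2)"
      using dirichlet_norm_expansion[OF uniq] by simp
    also have "\<dots> < e"
      using less \<open>e > 0\<close> by (simp add: real_less_lsqrt)
    finally show ?thesis using \<open>u \<in> span (orbit_of ?T ?x)\<close> by blast
  qed
  have "?x \<in> dirichlet_space \<beta> \<Lambda>"
    using orbit_coeff[of 0] by (auto simp: dirichlet_space_def dirichlet_monomial_def)
  then show ?thesis
    unfolding cyclic_on_def using approx by blast
qed

end
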